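(* Let $p\in(1,+\infty)$ and $\alpha>0$, and let $V(t)=\frac{|t^2-\alpha^2|^p}{p}$ for $t\in\mathbb{R}$. Then the unique solution $q$ of the problem $$-\left(|u'|^{p-2}u'\right)'+V'(u)=0\ \text{ in }\mathbb{R},\qquad u(0)=0,\qquad u(\pm\infty)=\pm\alpha,$$ is given by $$q(t)=\alpha\tanh\left(\frac{\alpha t}{\sqrt[p]{p-1}}\right).$$
   Context: $u(\pm\infty)=\pm\alpha$ means $\lim_{t\to+\infty}u(t)=\alpha$ and $\lim_{t\to-\infty}u(t)=-\alpha$. The expression $|s|^{p-2}s$ is read as $0$ at $s=0$. Solutions are understood as functions in $C^{1,\gamma}_{\mathrm{loc}}(\mathbb{R})$ for some $\gamma\in(0,1)$ satisfying the equation. *)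

theory Defs
  imports "HOL-Analysis.Analysis"
begin

definition double_well :: "real \<Rightarrow> real \<Rightarrow> real \<Rightarrow> real" where
  "double_well p \<alpha> t = \<bar>t\<^sup>2 - \<alpha>\<^sup>2\<bar> powr p / p"

(* The value at s = 0 is 0, also for p < 2. *)
definition p_flux :: "real \<Rightarrow> real \<Rightarrow> real" where
  "p_flux p s = \<bar>s\<bar> powr (p - 2) * s"

definition C1_Holder_loc :: "real \<Rightarrow> (real \<Rightarrow> real) \<Rightarrow> bool" where
  "C1_Holder_loc \<gamma> u \<longleftrightarrow>
     (\<forall>t. u differentiable (at t)) \<and>
     (\<forall>K. compact K \<longrightarrow>
        (\<exists>C. \<forall>x\<in>K. \<forall>y\<in>K. \<bar>deriv u x - deriv u y\<bar> \<le> C * \<bar>x - y\<bar> powr \<gamma>))"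

(* C_c^\<infinity>(\<real>) *)
definition test_function :: "(real \<Rightarrow> real) \<Rightarrow> bool" where
  "test_function \<phi> \<longleftrightarrow>
     (\<forall>n t. (deriv ^^ n) \<phi> differentiable (at t)) \<and> compact (closure {t. \<phi> t \<noteq> 0})"

(* Two senses in which u can satisfy -(|u'|^(p-2) u')' + V'(u) = 0 on the real line:
   pointwise, and in the sense of distributions. *)
definition pointwise_equation :: "real \<Rightarrow> (real \<Rightarrow> real) \<Rightarrow> (real \<Rightarrow> real) \<Rightarrow> bool" where
  "pointwise_equation p V u \<longleftrightarrow>
     (\<forall>t. (\<lambda>s. p_flux p (deriv u s)) differentiable (at t) \<and>
          - deriv (\<lambda>s. p_flux p (deriv u s)) t + deriv V (u t) = 0)"

definition weak_equation :: "real \<Rightarrow> (real \<Rightarrow> real) \<Rightarrow> (real \<Rightarrow> real) \<Rightarrow> bool" where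
  "weak_equation p V u \<longleftrightarrow>
     (\<forall>\<phi>. test_function \<phi> \<longrightarrow>
        (LINT t|lborel. p_flux p (deriv u t) * deriv \<phi> t + deriv V (u t) * \<phi> t) = 0)"

(* The problem for u, relative to the sense E in which the equation is required to hold. *)
definition heteroclinic_solution ::
    "(real \<Rightarrow> (real \<Rightarrow> real) \<Rightarrow> (real \<Rightarrow> real) \<Rightarrow> bool) \<Rightarrow> real \<Rightarrow> real \<Rightarrow> (real \<Rightarrow> real) \<Rightarrow> bool" where
  "heteroclinic_solution E p \<alpha> u \<longleftrightarrow>
     (\<exists>\<gamma>. 0 < \<gamma> \<and> \<gamma> < 1 \<and> C1_Holder_loc \<gamma> u) \<and>
     E p (double_well p \<alpha>) u \<and>
     u 0 = 0 \<and> (u \<longlongrightarrow> \<alpha>) at_top \<and> (u \<longlongrightarrow> - \<alpha>) at_bot"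

end

theory Submission
  imports Defs
begin

text \<open>
  Write \<open>v\<close> for \<open>u'\<close> and \<open>w\<close> for the flux \<open>|v|\<^bsup>p-2\<^esup> v\<close>. The equation says
  \<open>w' = V'(u)\<close>, in whichever of the two senses it is read: \<open>w\<close> and \<open>V'(u)\<close> are continuous, so by
  the du Bois-Reymond lemma the distributional equation is the classical one
  (\<open>weak_derivative_iff\<close>). Hence it is enough to treat the pointwise equation.

  Multiplication by \<open>u'\<close> yields conservation of energy: \<open>(p - 1)/p |u'|\<^sup>p - V(u)\<close> is constant.
  Because \<open>v\<close> itself need not be differentiable, this is computed through \<open>w\<close>: with the
  conjugate exponent \<open>p' = p/(p - 1)\<close> one has \<open>|v|\<^sup>p = |w|\<^bsup>p'\<^esup>\<close>, and \<open>|w|\<^bsup>p'\<^esup>\<close> is differentiable with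
  derivative \<open>p' v w'\<close>. Since \<open>u\<close> converges at infinity, \<open>u'\<close> is small along some sequence going to
  infinity, so the constant is \<open>-V(\<alpha>) = 0\<close> (\<open>equipartition\<close>). For the double well this is
  the first-order equation \<open>|u'| = c |u\<^sup>2 - \<alpha>\<^sup>2|\<close> with \<open>c\<^sup>p = 1/(p - 1)\<close>.

  The right-hand side is locally Lipschitz in \<open>u\<close>, so a Gronwall argument shows that \<open>u\<close>, starting
  at 0, never reaches \<open>\<plusminus>\<alpha>\<close>. Therefore \<open>u'\<close> never vanishes; it has a constant sign, which is
  positive because \<open>u\<close> tends to \<open>\<alpha> > 0\<close>. So \<open>u' = c (\<alpha>\<^sup>2 - u\<^sup>2)\<close>, an initial value problem
  that the scaled hyperbolic tangent solves too, and Gronwall applied to the difference of the two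
  solutions identifies them (\<open>eikonal_unique\<close>).
\<close>

section \<open>Smooth bumps\<close>

definition exp_inverse_power :: "nat \<Rightarrow> real \<Rightarrow> real" where
  "exp_inverse_power k x = (if 0 < x then exp (- inverse x) * inverse x ^ k else 0)"

text \<open>
  Lowering the index multiplies by \<open>x\<close>, also for \<open>x \<le> 0\<close>. This turns difference quotients at 0
  into members of the family, and lets sums of members be rewritten with one common index.
\<close>

lemma exp_inverse_power_Suc: "exp_inverse_power k x = x * exp_inverse_power (Suc k) x"
  by (simp add: exp_inverse_power_def)

lemma exp_inverse_power_tendsto_0: "(exp_inverse_power k \<longlongrightarrow> 0) (at 0)"
proof -
  have "((\<lambda>x::real. inverse x ^ k / exp (inverse x)) \<longlongrightarrow> 0) (at_right 0)"
    by (rule filterlim_compose[OF tendsto_power_div_exp_0 filterlim_inverse_at_top_right])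
  moreover have "eventually (\<lambda>x. inverse x ^ k / exp (inverse x) = exp_inverse_power k x) (at_right 0)"
    unfolding eventually_at_filter
    by (rule always_eventually) (auto simp: exp_inverse_power_def exp_minus field_simps)
  ultimately have right: "(exp_inverse_power k \<longlongrightarrow> 0) (at_right 0)"
    using Lim_transform_eventually by blast
  have "eventually (\<lambda>x. exp_inverse_power k x = 0) (at_left 0)"
    unfolding eventually_at_filter
    by (rule always_eventually) (auto simp: exp_inverse_power_def)
  then have "(exp_inverse_power k \<longlongrightarrow> 0) (at_left 0)"
    by (rule tendsto_eventually)
  with right show ?thesis
    by (simp add: filterlim_split_at)
qed

lemma exp_inverse_power_has_derivative:
  "(exp_inverse_power k has_real_derivative
     exp_inverse_power (k + 2) x - real k * exp_inverse_power (k + 1) x) (at x)"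
proof (cases x "0::real" rule: linorder_cases)
  case less
  have "(exp_inverse_power k has_real_derivative 0) (at x)"
    by (rule has_field_derivative_transform_within_open[of "\<lambda>_. 0" _ _ "{..<0}"])
      (use less in \<open>auto simp: exp_inverse_power_def\<close>)
  then show ?thesis
    using less by (simp add: exp_inverse_power_def)
next
  case equal
  have "(exp_inverse_power k has_real_derivative 0) (at 0)"
    unfolding has_field_derivative_iff
    by (rule Lim_transform_eventually[OF exp_inverse_power_tendsto_0[of "Suc k"]])
      (auto simp: eventually_at_filter exp_inverse_power_def divide_inverse intro!: always_eventually)
  then show ?thesis
    using equal by (simp add: exp_inverse_power_def)
next
  case greater
  have "((\<lambda>x. exp (- inverse x) * inverse x ^ k) has_real_derivative
     exp_inverse_power (k + 2) x - real k * exp_inverse_power (k + 1) x) (at x)"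
    using greater
    by (auto intro!: derivative_eq_intros simp: exp_inverse_power_def power2_eq_square algebra_simps)
      (cases k; simp)
  then show ?thesis
    by (rule has_field_derivative_transform_within_open[of _ _ _ "{0<..}"])
      (use greater in \<open>auto simp: exp_inverse_power_def\<close>)
qed

text \<open>
  The family, for fixed \<open>r\<close>, is closed under differentiation; smoothness of all its members
  follows with no bookkeeping of higher derivatives.
\<close>

definition poly_bump :: "real poly \<Rightarrow> real poly \<Rightarrow> nat \<Rightarrow> real \<Rightarrow> real" where
  "poly_bump r s k = (\<lambda>t. poly s t * exp_inverse_power k (poly r t))"

lemma poly_bump_has_derivative:
  "(poly_bump r s k has_real_derivative
     poly_bump r (pderiv s * r\<^sup>2 + s * pderiv r * (1 - smult (real k) r)) (k + 2) t) (at t)"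
proof -
  have "(poly_bump r s k has_real_derivative
     poly (pderiv s) t * exp_inverse_power k (poly r t) +
     poly s t * ((exp_inverse_power (k + 2) (poly r t) - real k * exp_inverse_power (k + 1) (poly r t))
       * poly (pderiv r) t)) (at t)"
    unfolding poly_bump_def
    by (rule DERIV_cong[OF DERIV_mult[OF poly_DERIV
          DERIV_chain2[OF exp_inverse_power_has_derivative poly_DERIV]]]) (simp add: algebra_simps)
  moreover have "exp_inverse_power k (poly r t) = (poly r t)\<^sup>2 * exp_inverse_power (k + 2) (poly r t)"
    "exp_inverse_power (k + 1) (poly r t) = poly r t * exp_inverse_power (k + 2) (poly r t)"
    using exp_inverse_power_Suc[of k "poly r t"] exp_inverse_power_Suc[of "Suc k" "poly r t"]
    by (simp_all add: power2_eq_square)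
  then have "poly (pderiv s) t * exp_inverse_power k (poly r t) +
     poly s t * ((exp_inverse_power (k + 2) (poly r t) - real k * exp_inverse_power (k + 1) (poly r t))
       * poly (pderiv r) t) =
     poly_bump r (pderiv s * r\<^sup>2 + s * pderiv r * (1 - smult (real k) r)) (k + 2) t"
    by (simp only:) (simp add: poly_bump_def algebra_simps)
  ultimately show ?thesis
    by (simp only:)
qed

lemma poly_bump_smooth: "(deriv ^^ n) (poly_bump r s k) differentiable (at t)"
proof -
  have deriv: "deriv (poly_bump r s k) =
      poly_bump r (pderiv s * r\<^sup>2 + s * pderiv r * (1 - smult (real k) r)) (k + 2)" for s k
    using poly_bump_has_derivative by (blast intro: DERIV_imp_deriv)
  have "\<exists>s' k'. (deriv ^^ n) (poly_bump r s k) = poly_bump r s' k'" for n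
  proof (induction n)
    case 0
    show ?case by auto
  next
    case (Suc n)
    then obtain s' k' where "(deriv ^^ n) (poly_bump r s k) = poly_bump r s' k'"
      by blast
    then have "(deriv ^^ Suc n) (poly_bump r s k) = deriv (poly_bump r s' k')"
      by simp
    then show ?case unfolding deriv by blast
  qed
  then obtain s' k' where "(deriv ^^ n) (poly_bump r s k) = poly_bump r s' k'"
    by blast
  then show ?thesis
    using poly_bump_has_derivative real_differentiable_def by fastforce
qed

lemma smooth_bump_exists:
  fixes \<epsilon> :: real
  assumes "0 < \<epsilon>"
  obtains \<rho> :: "real \<Rightarrow> real" where "\<And>n t. (deriv ^^ n) \<rho> differentiable (at t)"
    "\<And>t. 0 \<le> \<rho> t" "0 < \<rho> 0" "\<And>t. \<epsilon> \<le> \<bar>t\<bar> \<Longrightarrow> \<rho> t = 0"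
proof
  let ?\<rho> = "poly_bump [:\<epsilon>\<^sup>2, 0, -1:] 1 0"
  show "(deriv ^^ n) ?\<rho> differentiable (at t)" for n t
    by (rule poly_bump_smooth)
  show "0 \<le> ?\<rho> t" for t
    by (simp add: poly_bump_def exp_inverse_power_def)
  show "0 < ?\<rho> 0"
    using assms by (simp add: poly_bump_def exp_inverse_power_def)
  show "?\<rho> t = 0" if "\<epsilon> \<le> \<bar>t\<bar>" for t
  proof -
    have "\<epsilon>\<^sup>2 \<le> t\<^sup>2" using that assms power_mono[of \<epsilon> "\<bar>t\<bar>" 2] by simp
    then show ?thesis by (simp add: poly_bump_def exp_inverse_power_def power2_eq_square)
  qed
qed

section \<open>Weak derivatives of continuous functions\<close>

lemma antiderivative_exists:
  fixes g :: "real \<Rightarrow> real"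
  assumes "continuous_on UNIV g"
  obtains G where "\<And>t. (G has_real_derivative g t) (at t)"
proof -
  have "\<exists>G. \<forall>t. -\<infinity> < ereal t \<longrightarrow> ereal t < \<infinity> \<longrightarrow> (G has_vector_derivative g t) (at t)"
    using assms by (intro einterval_antiderivative) (auto simp: continuous_on_eq_continuous_at)
  then show ?thesis
    using that by (auto simp: has_real_derivative_iff_has_vector_derivative)
qed

lemma integral_compact_support:
  fixes f :: "real \<Rightarrow> real"
  assumes "continuous_on UNIV f" "\<And>t. M < \<bar>t\<bar> \<Longrightarrow> f t = 0"
  shows "integrable lborel f" "(LINT t|lborel. f t) = integral {-M..M} f"
proof -
  have int: "set_integrable lborel {-M..M} f"
    using assms by (intro borel_integrable_atLeastAtMost') (auto intro: continuous_on_subset)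
  then have "(LINT t:{-M..M}|lborel. f t) = integral {-M..M} f"
    by (rule set_borel_integral_eq_integral)
  moreover have "(\<lambda>t. indicator {-M..M} t *\<^sub>R f t) = f"
    proof
    fix t show "indicator {-M..M} t *\<^sub>R f t = f t"
      using assms(2)[of t] by (cases "M < \<bar>t\<bar>") (auto simp: indicator_def)
  qed
  ultimately show "integrable lborel f" "(LINT t|lborel. f t) = integral {-M..M} f"
    using int by (simp_all add: set_lebesgue_integral_def set_integrable_def)
qed

lemma integral_derivative_compact_support:
  fixes f f' :: "real \<Rightarrow> real"
  assumes "\<And>t. (f has_real_derivative f' t) (at t)" "continuous_on UNIV f'"
    "\<And>t. M < \<bar>t\<bar> \<Longrightarrow> f t = 0"
  shows "(LINT t|lborel. f' t) = 0"
proof -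
  \<comment> \<open>Strictly beyond \<open>M\<close>, so that \<open>f\<close> vanishes at the end points, and positive, so that \<open>-N \<le> N\<close>.\<close>
  define N where "N = max M 0 + 1"
  have f': "f' t = 0" if "N < \<bar>t\<bar>" for t
  proof -
    have "((\<lambda>_. 0) has_real_derivative 0) (at t)" by simp
    moreover have "open {t::real. M < \<bar>t\<bar>}"
      by (intro open_Collect_less continuous_intros)
    ultimately have "(f has_real_derivative 0) (at t)"
      using assms(3) that by (elim has_field_derivative_transform_within_open) (auto simp: N_def)
    with assms(1) show ?thesis by (metis DERIV_unique)
  qed
  have "(f' has_integral f N - f (- N)) {-N..N}"
    using assms(1) by (intro fundamental_theorem_of_calculus)
     (auto simp: N_def has_real_derivative_iff_has_vector_derivative intro: has_vector_derivative_at_within)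
  moreover have "f N = 0" "f (- N) = 0"
    using assms(3)[of N] assms(3)[of "-N"] by (auto simp: N_def)
  ultimately show ?thesis
    using integral_compact_support(2)[OF assms(2) f'] by (simp add: integral_unique)
qed

lemma test_function_has_derivative:
  assumes "test_function \<phi>"
  shows "(\<phi> has_real_derivative deriv \<phi> t) (at t)"
proof -
  have "(deriv ^^ 0) \<phi> differentiable (at t)"
    using assms unfolding test_function_def by blast
  then show ?thesis
    by (simp add: DERIV_deriv_iff_real_differentiable)
qed

lemma test_function_continuous_deriv:
  assumes "test_function \<phi>"
  shows "continuous_on A (deriv \<phi>)"
proof -
  have "(deriv ^^ 1) \<phi> differentiable (at t)" for t
    using assms unfolding test_function_def by blast
  then show ?thesis
    by (intro continuous_at_imp_continuous_on ballI) (simp add: differentiable_imp_continuous_within)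
qed

lemma test_function_vanishes:
  assumes "test_function \<phi>"
  obtains M where "\<And>t. M < \<bar>t\<bar> \<Longrightarrow> \<phi> t = 0"
proof -
  have "bounded {t. \<phi> t \<noteq> 0}"
    using assms unfolding test_function_def
    by (metis bounded_subset closure_subset compact_imp_bounded)
  then obtain M where "\<forall>t. \<phi> t \<noteq> 0 \<longrightarrow> \<bar>t\<bar> \<le> M"
    by (auto simp: bounded_iff)
  then show ?thesis using that by (metis not_le)
qed

text \<open>
  The derivatives of test functions are the smooth compactly supported functions of mean zero.
  The difference of two translates of a bump is such a function; its antiderivative is the
  difference of two translates of a smooth step, and those steps agree outside a bounded set.
\<close>

lemma test_function_bump_difference:
  fixes a b \<epsilon> :: real
  assumes "0 < \<epsilon>"
  obtains \<phi> \<rho> :: "real \<Rightarrow> real" where "test_function \<phi>"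
    "\<And>t. deriv \<phi> t = \<rho> (t - a) - \<rho> (t - b)"
    "\<And>t. 0 \<le> \<rho> t" "0 < \<rho> 0" "\<And>t. \<epsilon> \<le> \<bar>t\<bar> \<Longrightarrow> \<rho> t = 0"
proof -
  obtain \<rho> :: "real \<Rightarrow> real" where smooth: "\<And>n t. (deriv ^^ n) \<rho> differentiable (at t)"
    and \<rho>: "\<And>t. 0 \<le> \<rho> t" "0 < \<rho> 0" "\<And>t. \<epsilon> \<le> \<bar>t\<bar> \<Longrightarrow> \<rho> t = 0"
    using smooth_bump_exists[OF assms] by metis
  have "\<rho> differentiable (at t)" for t
    using smooth[of 0] by simp
  then have "continuous_on UNIV \<rho>"
    by (simp add: continuous_at_imp_continuous_on differentiable_imp_continuous_within)
  then obtain F where F: "\<And>t. (F has_real_derivative \<rho> t) (at t)"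
    using antiderivative_exists by metis
  define \<phi> where "\<phi> = (\<lambda>t. F (t - a) - F (t - b))"
  have \<phi>: "(\<phi> has_real_derivative \<rho> (t - a) - \<rho> (t - b)) (at t)" for t
    unfolding \<phi>_def by (auto intro!: derivative_eq_intros DERIV_chain2[OF F])
  then have deriv_\<phi>: "deriv \<phi> = (\<lambda>t. \<rho> (t - a) - \<rho> (t - b))"
    by (blast intro: DERIV_imp_deriv)
  have D: "((deriv ^^ n) \<rho> has_real_derivative (deriv ^^ Suc n) \<rho> t) (at t)" for n t
    using smooth[of n t] by (simp add: DERIV_deriv_iff_real_differentiable)
  have iter: "(deriv ^^ n) (deriv \<phi>) = (\<lambda>t. (deriv ^^ n) \<rho> (t - a) - (deriv ^^ n) \<rho> (t - b))" for n
  proof (induction n)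
    case 0
    show ?case by (simp add: deriv_\<phi>)
  next
    case (Suc n)
    have "((deriv ^^ n) (deriv \<phi>) has_real_derivative
        (deriv ^^ Suc n) \<rho> (t - a) - (deriv ^^ Suc n) \<rho> (t - b)) (at t)" for t
      unfolding Suc by (auto intro!: derivative_eq_intros DERIV_chain2[OF D])
    then have "deriv ((deriv ^^ n) (deriv \<phi>)) =
        (\<lambda>t. (deriv ^^ Suc n) \<rho> (t - a) - (deriv ^^ Suc n) \<rho> (t - b))"
      by (blast intro: DERIV_imp_deriv)
    then show ?case by simp
  qed
  have "(deriv ^^ n) \<phi> differentiable (at t)" for n t
  proof (cases n)
    case 0
    then show ?thesis using \<phi> by (auto simp: real_differentiable_def)
  next
    case (Suc m)
    then have "(deriv ^^ n) \<phi> = (deriv ^^ m) (deriv \<phi>)"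
      by (simp add: funpow_swap1)
    moreover have "(\<lambda>t. (deriv ^^ m) \<rho> (t - a) - (deriv ^^ m) \<rho> (t - b)) differentiable (at t)"
      unfolding real_differentiable_def
      by (rule exI) (auto intro!: derivative_eq_intros DERIV_chain2[OF D])
    ultimately show ?thesis by (simp add: iter)
  qed
  moreover have "compact (closure {t. \<phi> t \<noteq> 0})"
  proof -
    have const: "\<exists>c. \<forall>t\<in>S. F t = c" if "convex S" "\<And>t. t \<in> S \<Longrightarrow> \<epsilon> \<le> \<bar>t\<bar>" for S
      by (rule has_field_derivative_zero_constant[OF that(1)])
        (metis F \<rho>(3) that(2) has_field_derivative_at_within)
    obtain c where c: "\<And>t. \<epsilon> \<le> t \<Longrightarrow> F t = c"
      using const[of "{\<epsilon>..}"] by fastforce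
    obtain d where d: "\<And>t. t \<le> - \<epsilon> \<Longrightarrow> F t = d"
      using const[of "{..-\<epsilon>}"] by fastforce
    have "\<phi> t = 0" if "\<epsilon> + \<bar>a\<bar> + \<bar>b\<bar> < \<bar>t\<bar>" for t
    proof (cases "0 \<le> t")
      case True
      then show ?thesis using that c[of "t - a"] c[of "t - b"] by (simp add: \<phi>_def)
    next
      case False
      then show ?thesis using that d[of "t - a"] d[of "t - b"] by (simp add: \<phi>_def)
    qed
    then have "bounded {t. \<phi> t \<noteq> 0}"
      unfolding bounded_iff by (intro exI[of _ "\<epsilon> + \<bar>a\<bar> + \<bar>b\<bar>"]) (fastforce simp: not_less)
    then show ?thesis by simp
  qed
  ultimately have "test_function \<phi>"
    by (simp add: test_function_def)
  then show ?thesis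
    using that[of \<phi> \<rho>] \<rho> deriv_\<phi> by simp
qed

text \<open>
  The weak equation says that \<open>h = w - G\<close> is orthogonal to the derivatives of all test functions. If
  \<open>h\<close> were larger at \<open>b\<close> than at \<open>a\<close>, then for \<open>m\<close> strictly between the two values the product
  of \<open>m - h\<close> with (bump at \<open>a\<close>) minus (bump at \<open>b\<close>) would be nonnegative for narrow bumps and
  positive at \<open>a\<close>, and its integral could not vanish.
\<close>

lemma weak_derivative_imp_le:
  fixes w g G :: "real \<Rightarrow> real"
  assumes w: "continuous_on UNIV w" and g: "continuous_on UNIV g"
    and G: "\<And>t. (G has_real_derivative g t) (at t)"
    and weak: "\<And>\<phi>. test_function \<phi> \<Longrightarrow> (LINT t|lborel. w t * deriv \<phi> t + g t * \<phi> t) = 0"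
  shows "w b - G b \<le> w a - G a"
proof (rule ccontr)
  define h where "h = (\<lambda>t. w t - G t)"
  define m where "m = (h a + h b) / 2"
  assume "\<not> ?thesis"
  then have m: "h a < m" "m < h b"
    by (simp_all add: h_def m_def)
  have contG: "continuous_on A G" for A
    using G by (meson DERIV_continuous continuous_at_imp_continuous_on)
  have conth: "continuous_on A h" for A
    unfolding h_def using w by (intro continuous_intros contG) (auto intro: continuous_on_subset)
  have "isCont h a" "isCont h b"
    using conth[of UNIV] by (simp_all add: continuous_on_eq_continuous_at)
  then have "(h \<longlongrightarrow> h a) (nhds a)" "(h \<longlongrightarrow> h b) (nhds b)"
    by (simp_all add: isCont_def tendsto_at_iff_tendsto_nhds)
  then have "eventually (\<lambda>t. h t < m) (nhds a)" "eventually (\<lambda>t. m < h t) (nhds b)"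
    using m order_tendstoD by blast+
  then obtain d e where "0 < d" "\<And>t. dist t a < d \<Longrightarrow> h t < m" "0 < e" "\<And>t. dist t b < e \<Longrightarrow> m < h t"
    unfolding eventually_nhds_metric by blast
  then obtain \<epsilon> where \<epsilon>: "0 < \<epsilon>" "\<And>t. \<bar>t - a\<bar> < \<epsilon> \<Longrightarrow> h t < m" "\<And>t. \<bar>t - b\<bar> < \<epsilon> \<Longrightarrow> m < h t"
    using that[of "min d e"] by (auto simp: dist_real_def)
  obtain \<phi> \<rho> :: "real \<Rightarrow> real" where \<phi>: "test_function \<phi>"
    and d\<phi>: "\<And>t. deriv \<phi> t = \<rho> (t - a) - \<rho> (t - b)"
    and \<rho>: "\<And>t. 0 \<le> \<rho> t" "0 < \<rho> 0" "\<And>t. \<epsilon> \<le> \<bar>t\<bar> \<Longrightarrow> \<rho> t = 0"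
    using test_function_bump_difference[OF \<epsilon>(1)] by metis
  note D\<phi> = test_function_has_derivative[OF \<phi>]
  have cont\<phi>: "continuous_on A \<phi>" for A
    using D\<phi> by (meson DERIV_continuous continuous_at_imp_continuous_on)
  note cont = cont\<phi> test_function_continuous_deriv[OF \<phi>] contG w g conth
  obtain M0 where M0: "\<And>t. M0 < \<bar>t\<bar> \<Longrightarrow> \<phi> t = 0"
    using test_function_vanishes[OF \<phi>] by metis
  define M where "M = \<bar>M0\<bar> + \<bar>a\<bar> + \<bar>b\<bar> + \<epsilon>"
  have M: "\<phi> t = 0" "deriv \<phi> t = 0" if "M < \<bar>t\<bar>" for t
  proof -
    have "M0 < \<bar>t\<bar>" "\<epsilon> \<le> \<bar>t - a\<bar>" "\<epsilon> \<le> \<bar>t - b\<bar>"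
      using that \<epsilon>(1) unfolding M_def by linarith+
    then show "\<phi> t = 0" "deriv \<phi> t = 0"
      by (simp_all add: M0 \<rho>(3) d\<phi>)
  qed
  \<comment> \<open>\<open>?i\<close> is the derivative of \<open>(G + m) \<phi>\<close>, so the integrals of \<open>?i\<close> and \<open>?j\<close> both vanish, and \<open>?f = ?i - ?j\<close>.\<close>
  let ?f = "\<lambda>t. (m - h t) * deriv \<phi> t"
  let ?i = "\<lambda>t. g t * \<phi> t + (G t + m) * deriv \<phi> t"
  let ?j = "\<lambda>t. w t * deriv \<phi> t + g t * \<phi> t"
  have "(LINT t|lborel. ?i t) = 0"
    by (rule integral_derivative_compact_support[of "\<lambda>t. (G t + m) * \<phi> t" _ M])
      (auto intro!: derivative_eq_intros G D\<phi> continuous_intros cont simp: M algebra_simps)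
  moreover have "(LINT t|lborel. ?j t) = 0"
    by (rule weak[OF \<phi>])
  moreover have "integrable lborel ?i" "integrable lborel ?j"
    by (rule integral_compact_support[of _ M]; auto intro!: continuous_intros cont simp: M)+
  ultimately have "(LINT t|lborel. ?i t - ?j t) = 0"
    by (simp only: Bochner_Integration.integral_diff diff_self)
  moreover have "?i t - ?j t = ?f t" for t
    by (simp add: h_def algebra_simps)
  ultimately have "(LINT t|lborel. ?f t) = 0"
    by (simp only:)
  moreover have "(LINT t|lborel. ?f t) = integral {-M..M} ?f"
    by (rule integral_compact_support) (auto intro!: continuous_intros cont simp: M)
  ultimately have "integral {-M..M} ?f = 0"
    by simp
  moreover have sign: "0 \<le> (m - h t) * \<rho> (t - a)" "(m - h t) * \<rho> (t - b) \<le> 0" for t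
  proof -
    show "0 \<le> (m - h t) * \<rho> (t - a)"
      using \<epsilon>(2)[of t] \<rho>(1,3)[of "t - a"] by (cases "\<bar>t - a\<bar> < \<epsilon>") auto
    show "(m - h t) * \<rho> (t - b) \<le> 0"
      using \<epsilon>(3)[of t] \<rho>(1,3)[of "t - b"] by (cases "\<bar>t - b\<bar> < \<epsilon>") (auto simp: mult_le_0_iff)
  qed
  have "0 \<le> ?f t" for t
    using sign[of t] by (simp add: d\<phi> algebra_simps)
  moreover have "- M < M"
    using \<epsilon>(1) by (simp add: M_def)
  moreover have "continuous_on {-M..M} ?f"
    by (intro continuous_intros cont)
  ultimately have "\<forall>t\<in>{-M..M}. ?f t = 0"
    by (subst (asm) integral_eq_0_iff) auto
  moreover have "a \<in> {-M..M}"
    using \<epsilon>(1) by (auto simp: M_def)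
  ultimately have "?f a = 0"
    by blast
  moreover have "0 < (m - h a) * \<rho> 0"
    using m \<rho>(2) by simp
  ultimately show False
    using sign(2)[of a] by (simp add: d\<phi> algebra_simps)
qed

text \<open>
  The du Bois-Reymond lemma; the converse direction is integration by parts.
\<close>

lemma weak_derivative_iff:
  fixes w g :: "real \<Rightarrow> real"
  assumes w: "continuous_on UNIV w" and g: "continuous_on UNIV g"
  shows "(\<forall>\<phi>. test_function \<phi> \<longrightarrow> (LINT t|lborel. w t * deriv \<phi> t + g t * \<phi> t) = 0) \<longleftrightarrow>
    (\<forall>t. (w has_real_derivative g t) (at t))"
proof
  assume weak: "\<forall>\<phi>. test_function \<phi> \<longrightarrow> (LINT t|lborel. w t * deriv \<phi> t + g t * \<phi> t) = 0"
  obtain G where G: "\<And>t. (G has_real_derivative g t) (at t)"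
    using antiderivative_exists[OF g] by metis
  have "w t - G t = w 0 - G 0" for t
    using weak_derivative_imp_le[OF w g G] weak by (metis order_antisym)
  then have "w = (\<lambda>t. G t + (w 0 - G 0))"
    by (auto simp: algebra_simps)
  moreover have "((\<lambda>t. G t + (w 0 - G 0)) has_real_derivative g t) (at t)" for t
    by (auto intro!: derivative_eq_intros G)
  ultimately show "\<forall>t. (w has_real_derivative g t) (at t)"
    by metis
next
  assume w': "\<forall>t. (w has_real_derivative g t) (at t)"
  show "\<forall>\<phi>. test_function \<phi> \<longrightarrow> (LINT t|lborel. w t * deriv \<phi> t + g t * \<phi> t) = 0"
  proof (intro allI impI)
    fix \<phi> assume \<phi>: "test_function \<phi>"
    obtain M where M: "\<And>t. M < \<bar>t\<bar> \<Longrightarrow> \<phi> t = 0"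
      using test_function_vanishes[OF \<phi>] by metis
    note D\<phi> = test_function_has_derivative[OF \<phi>]
    have cont\<phi>: "continuous_on UNIV \<phi>"
      using D\<phi> by (meson DERIV_continuous continuous_at_imp_continuous_on)
    show "(LINT t|lborel. w t * deriv \<phi> t + g t * \<phi> t) = 0"
      by (rule integral_derivative_compact_support[of "\<lambda>t. w t * \<phi> t" _ M])
        (auto intro!: derivative_eq_intros D\<phi> w'[rule_format] continuous_intros w g cont\<phi>
           test_function_continuous_deriv[OF \<phi>] simp: M algebra_simps)
  qed
qed


section \<open>The flux and the double-well potential\<close>

lemma abs_p_flux: "\<bar>p_flux p s\<bar> = \<bar>s\<bar> powr (p - 1)"
proof (cases "s = 0")
  case False
  then have "\<bar>s\<bar> powr (p - 2) * \<bar>s\<bar> powr 1 = \<bar>s\<bar> powr (p - 1)"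
    by (simp only: powr_add[symmetric]) simp
  with False show ?thesis by (simp add: p_flux_def abs_mult)
qed (simp add: p_flux_def)

lemma p_flux_tendsto_0:
  assumes "1 < p"
  shows "(p_flux p \<longlongrightarrow> 0) (at 0)"
proof -
  have "((\<lambda>s::real. \<bar>s\<bar> powr (p - 1)) \<longlongrightarrow> 0) (at 0)"
    using assms by (intro tendsto_zero_powrI[where b = "p - 1"] tendsto_rabs_zero tendsto_ident_at tendsto_const) auto
  then show ?thesis
    by (intro tendsto_rabs_zero_cancel[of "p_flux p"]) (simp add: abs_p_flux)
qed

lemma continuous_on_p_flux:
  assumes "1 < p"
  shows "continuous_on A (p_flux p)"
proof (intro continuous_at_imp_continuous_on ballI)
  fix s :: real
  show "isCont (p_flux p) s"
  proof (cases "s = 0")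
    case True
    then show ?thesis
      using p_flux_tendsto_0[OF assms] by (simp add: isCont_def p_flux_def)
  next
    case False
    then show ?thesis
      unfolding p_flux_def by (intro continuous_intros) auto
  qed
qed

text \<open>
  The fluxes of conjugate exponents are inverse to each other, so \<open>u'\<close> can be recovered from the
  flux; this replaces the missing second derivative of \<open>u\<close>.
\<close>

lemma p_flux_conjugate:
  assumes "1 < p"
  shows "p_flux (p / (p - 1)) (p_flux p s) = s"
proof (cases "s = 0")
  case False
  have "(p - 1) * (p / (p - 1) - 2) + (p - 2) = 0"
    using assms by (simp add: field_simps)
  then have "\<bar>p_flux p s\<bar> powr (p / (p - 1) - 2) * \<bar>s\<bar> powr (p - 2) = 1"
    using False by (simp add: abs_p_flux powr_powr flip: powr_add)
  then show ?thesis
    unfolding p_flux_def[of "p / (p - 1)"] by (simp add: p_flux_def[of p] mult.assoc[symmetric])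
qed (simp add: p_flux_def)

lemma abs_powr_has_derivative:
  assumes "1 < p"
  shows "((\<lambda>x. \<bar>x\<bar> powr p) has_real_derivative p * p_flux p x) (at x)"
proof (cases x "0::real" rule: linorder_cases)
  case less
  have "p * (- x) powr (p - 1) * (- 1) = p * p_flux p x"
    using less abs_p_flux[of p x, symmetric] by (simp add: p_flux_def abs_mult)
  then have "((\<lambda>x. (- x) powr p) has_real_derivative p * p_flux p x) (at x)"
    using less by (auto intro!: derivative_eq_intros)
  then show ?thesis
    by (rule has_field_derivative_transform_within_open[of _ _ _ "{..<0}"]) (use less in auto)
next
  case equal
  have "((\<lambda>x. \<bar>x\<bar> powr p) has_real_derivative 0) (at 0)"
    unfolding has_field_derivative_iff
  proof (rule Lim_transform_eventually[OF p_flux_tendsto_0[OF assms]])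
    have "p_flux p x = \<bar>x\<bar> powr p / x" if "x \<noteq> 0" for x
    proof -
      have "\<bar>x\<bar> powr (p - 2) * (x * x) = \<bar>x\<bar> powr (p - 2) * \<bar>x\<bar> powr 2"
        by (simp add: power2_eq_square flip: abs_mult)
      also have "\<dots> = \<bar>x\<bar> powr p"
        by (simp only: powr_add[symmetric]) simp
      finally show ?thesis
        using that by (simp add: p_flux_def field_simps)
    qed
    then show "eventually (\<lambda>x. p_flux p x = (\<bar>x\<bar> powr p - \<bar>0\<bar> powr p) / (x - 0)) (at 0)"
      by (auto simp: eventually_at_filter intro!: always_eventually)
  qed
  then show ?thesis
    using equal by (simp add: p_flux_def)
next
  case greater
  have "p * x powr (p - 1) = p * p_flux p x"
    using greater abs_p_flux[of p x] by (simp add: p_flux_def abs_mult)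
  then have "((\<lambda>x. x powr p) has_real_derivative p * p_flux p x) (at x)"
    using greater by (auto intro!: derivative_eq_intros)
  then show ?thesis
    by (rule has_field_derivative_transform_within_open[of _ _ _ "{0<..}"]) (use greater in auto)
qed

lemma double_well_has_derivative:
  assumes "1 < p"
  shows "(double_well p \<alpha> has_real_derivative 2 * s * p_flux p (s\<^sup>2 - \<alpha>\<^sup>2)) (at s)"
proof -
  have "((\<lambda>s. \<bar>s\<^sup>2 - \<alpha>\<^sup>2\<bar> powr p) has_real_derivative p * p_flux p (s\<^sup>2 - \<alpha>\<^sup>2) * (2 * s)) (at s)"
    by (rule DERIV_chain2[OF abs_powr_has_derivative[OF assms]]) (auto intro!: derivative_eq_intros)
  from DERIV_cdivide[OF this, of p] show ?thesis
    using assms unfolding double_well_def[abs_def] by (simp add: mult_ac)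
qed

lemma deriv_double_well:
  assumes "1 < p"
  shows "deriv (double_well p \<alpha>) = (\<lambda>s. 2 * s * p_flux p (s\<^sup>2 - \<alpha>\<^sup>2))"
  using double_well_has_derivative[OF assms] by (blast intro: DERIV_imp_deriv)

lemma continuous_on_deriv_double_well:
  assumes "1 < p"
  shows "continuous_on A (deriv (double_well p \<alpha>))"
  unfolding deriv_double_well[OF assms]
  by (intro continuous_intros continuous_on_compose2[OF continuous_on_p_flux[OF assms, of UNIV]]) auto

section \<open>The regularity class and the two forms of the equation\<close>

lemma C1_Holder_loc_has_derivative:
  assumes "C1_Holder_loc \<gamma> u"
  shows "(u has_real_derivative deriv u t) (at t)"
  using assms by (simp add: C1_Holder_loc_def DERIV_deriv_iff_real_differentiable)

lemma C1_Holder_loc_continuous_deriv: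
  assumes "C1_Holder_loc \<gamma> u" "0 < \<gamma>"
  shows "continuous_on A (deriv u)"
proof (intro continuous_at_imp_continuous_on ballI)
  fix x :: real
  obtain C where C: "\<And>y. y \<in> cball x 1 \<Longrightarrow> \<bar>deriv u y - deriv u x\<bar> \<le> C * \<bar>y - x\<bar> powr \<gamma>"
    using assms(1) compact_cball[of x 1] unfolding C1_Holder_loc_def by (metis centre_in_cball zero_le_one)
  have "((\<lambda>y. \<bar>y - x\<bar> powr \<gamma>) \<longlongrightarrow> 0) (at x)"
    using assms(2) by (intro tendsto_zero_powrI[where b = \<gamma>] tendsto_rabs_zero LIM_zero tendsto_ident_at tendsto_const) auto
  then have lim: "((\<lambda>y. C * \<bar>y - x\<bar> powr \<gamma>) \<longlongrightarrow> 0) (at x)"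
    by (rule tendsto_mult_right_zero)
  have "eventually (\<lambda>y. y \<in> cball x 1) (at x)"
    by (auto simp: eventually_at dist_commute intro!: exI[of _ 1])
  then have "eventually (\<lambda>y. norm (deriv u y - deriv u x) \<le> C * \<bar>y - x\<bar> powr \<gamma>) (at x)"
    by eventually_elim (simp add: C)
  then have "((\<lambda>y. deriv u y - deriv u x) \<longlongrightarrow> 0) (at x)"
    by (rule Lim_null_comparison[OF _ lim])
  then show "isCont (deriv u) x"
    by (simp add: isCont_def LIM_zero_iff)
qed

text \<open>
  On a set of bounded diameter, \<open>|x - y|\<close> is at most a constant times \<open>|x - y|\<^bsup>\<gamma>\<^esup>\<close>.
\<close>

lemma C1_Holder_loc_if_C11:
  assumes v: "\<And>t. (u has_real_derivative v t) (at t)"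
    and L: "\<And>x y. \<bar>v x - v y\<bar> \<le> L * \<bar>x - y\<bar>" and "0 < \<gamma>" "\<gamma> < 1"
  shows "C1_Holder_loc \<gamma> u"
  unfolding C1_Holder_loc_def
proof (intro conjI allI impI)
  fix t show "u differentiable (at t)"
    using v by (auto simp: real_differentiable_def)
next
  fix K :: "real set" assume "compact K"
  have deriv: "deriv u = v"
    using v by (blast intro: DERIV_imp_deriv)
  have "0 \<le> L"
    using order_trans[OF abs_ge_zero L[of 1 0]] by simp
  obtain D where D: "\<And>x. x \<in> K \<Longrightarrow> \<bar>x\<bar> \<le> D"
    using compact_imp_bounded[OF \<open>compact K\<close>] by (auto simp: bounded_iff)
  have "\<bar>v x - v y\<bar> \<le> L * (2 * D) powr (1 - \<gamma>) * \<bar>x - y\<bar> powr \<gamma>" if "x \<in> K" "y \<in> K" for x y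
  proof -
    have "\<bar>x - y\<bar> = \<bar>x - y\<bar> powr (1 - \<gamma>) * \<bar>x - y\<bar> powr \<gamma>"
      by (cases "x = y") (auto simp flip: powr_add)
    also have "\<dots> \<le> (2 * D) powr (1 - \<gamma>) * \<bar>x - y\<bar> powr \<gamma>"
      using D[OF that(1)] D[OF that(2)] assms(4) by (intro mult_right_mono powr_mono2) auto
    finally show ?thesis
      using L[of x y] mult_left_mono[OF _ \<open>0 \<le> L\<close>] by (fastforce simp: mult.assoc intro: order_trans)
  qed
  then show "\<exists>C. \<forall>x\<in>K. \<forall>y\<in>K. \<bar>deriv u x - deriv u y\<bar> \<le> C * \<bar>x - y\<bar> powr \<gamma>"
    unfolding deriv by blast
qed

lemma pointwise_equation_iff:
  "pointwise_equation p V u \<longleftrightarrow>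
     (\<forall>t. ((\<lambda>s. p_flux p (deriv u s)) has_real_derivative deriv V (u t)) (at t))"
proof
  assume "pointwise_equation p V u"
  then show "\<forall>t. ((\<lambda>s. p_flux p (deriv u s)) has_real_derivative deriv V (u t)) (at t)"
    unfolding pointwise_equation_def
    by (metis DERIV_deriv_iff_real_differentiable add.inverse_inverse add_eq_0_iff)
next
  assume "\<forall>t. ((\<lambda>s. p_flux p (deriv u s)) has_real_derivative deriv V (u t)) (at t)"
  then show "pointwise_equation p V u"
    unfolding pointwise_equation_def real_differentiable_def
    by (metis DERIV_imp_deriv add.left_inverse)
qed

section \<open>Conservation of energy\<close>

text \<open>
  Formally \<open>w' = V'(u)\<close> is multiplied by \<open>u'\<close>. The kinetic term is written as a power of the flux,
  which is differentiable even where \<open>u'\<close> is not.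
\<close>

lemma first_integral:
  fixes u v V V' :: "real \<Rightarrow> real"
  assumes "1 < p" and u: "\<And>t. (u has_real_derivative v t) (at t)"
    and V: "\<And>x. (V has_real_derivative V' x) (at x)"
    and eq: "\<And>t. ((\<lambda>s. p_flux p (v s)) has_real_derivative V' (u t)) (at t)"
  obtains E where "\<And>t. (p - 1) / p * \<bar>v t\<bar> powr p - V (u t) = E"
proof -
  define p' where "p' = p / (p - 1)"
  have p': "1 < p'" "(p - 1) / p * p' = 1" "(p - 1) * p' = p"
    using assms(1) by (auto simp: p'_def field_simps)
  let ?e = "\<lambda>t. (p - 1) / p * \<bar>p_flux p (v t)\<bar> powr p' - V (u t)"
  have "(?e has_real_derivative 0) (at t)" for t
  proof -
    have "((\<lambda>t. \<bar>p_flux p (v t)\<bar> powr p') has_real_derivative p' * p_flux p' (p_flux p (v t)) * V' (u t)) (at t)"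
      by (rule DERIV_chain2[OF abs_powr_has_derivative[OF p'(1)] eq])
    then have "((\<lambda>t. \<bar>p_flux p (v t)\<bar> powr p') has_real_derivative p' * v t * V' (u t)) (at t)"
      using p_flux_conjugate[OF assms(1)] by (simp add: p'_def)
    from DERIV_diff[OF DERIV_cmult[OF this, of "(p - 1) / p"] DERIV_chain2[OF V u]]
    have "(?e has_real_derivative (p - 1) / p * p' * (v t * V' (u t)) - V' (u t) * v t) (at t)"
      by (simp add: mult.assoc)
    then show ?thesis
      by (simp only: p'(2)) (simp add: mult.commute)
  qed
  then have "?e t = ?e 0" for t
    using DERIV_isconst_all by blast
  moreover have "\<bar>p_flux p (v t)\<bar> powr p' = \<bar>v t\<bar> powr p" for t
    by (simp add: abs_p_flux powr_powr p'(3))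
  ultimately show ?thesis
    using that by metis
qed

text \<open>
  By the mean value theorem on \<open>[n, n + 1]\<close>, convergence of \<open>u\<close> gives points \<open>z\<^sub>n\<close> tending to infinity
  with \<open>u'(z\<^sub>n)\<close> tending to 0. The conserved energy, evaluated along them, is \<open>- V l\<close>. A sequence
  is used because \<open>u'\<close> might a priori have no limit.
\<close>

lemma equipartition:
  fixes u v V V' :: "real \<Rightarrow> real"
  assumes "1 < p" and u: "\<And>t. (u has_real_derivative v t) (at t)"
    and V: "\<And>x. (V has_real_derivative V' x) (at x)"
    and eq: "\<And>t. ((\<lambda>s. p_flux p (v s)) has_real_derivative V' (u t)) (at t)"
    and lim: "(u \<longlongrightarrow> l) at_top"
  shows "(p - 1) / p * \<bar>v t\<bar> powr p = V (u t) - V l"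
proof -
  obtain E where E: "\<And>t. (p - 1) / p * \<bar>v t\<bar> powr p - V (u t) = E"
    using first_integral[OF assms(1) u V eq] by metis
  have "\<exists>z>real n. z < real n + 1 \<and> u (real n + 1) - u (real n) = v z" for n
    using MVT2[of "real n" "real n + 1" u v] u by auto
  then obtain z where z: "\<And>n. real n < z n" "\<And>n. u (real n + 1) - u (real n) = v (z n)"
    by metis
  have z_top: "filterlim z at_top sequentially"
    by (rule filterlim_at_top_mono[OF filterlim_real_sequentially]) (use z(1) in \<open>auto intro!: always_eventually less_imp_le\<close>)
  have "filterlim (\<lambda>n. real n + 1) at_top sequentially"
    by (rule filterlim_at_top_mono[OF filterlim_real_sequentially]) auto
  then have "(\<lambda>n. u (real n + 1) - u (real n)) \<longlonglongrightarrow> l - l"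
    by (intro tendsto_diff filterlim_compose[OF lim] filterlim_real_sequentially)
  then have "(\<lambda>n. v (z n)) \<longlonglongrightarrow> 0"
    by (simp add: z(2))
  then have "(\<lambda>n. \<bar>v (z n)\<bar> powr p) \<longlonglongrightarrow> 0"
    using assms(1) by (intro tendsto_zero_powrI[where b = p] tendsto_rabs_zero tendsto_const) auto
  moreover have "(\<lambda>n. V (u (z n))) \<longlonglongrightarrow> V l"
    by (rule isCont_tendsto_compose[OF DERIV_isCont[OF V] filterlim_compose[OF lim z_top]])
  ultimately have "(\<lambda>n. (p - 1) / p * \<bar>v (z n)\<bar> powr p - V (u (z n))) \<longlonglongrightarrow> (p - 1) / p * 0 - V l"
    by (intro tendsto_intros)
  then have "E = - V l"
    unfolding E by (simp add: LIMSEQ_const_iff)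
  then show ?thesis using E[of t] by simp
qed

section \<open>The first-order equation\<close>

text \<open>
  The function \<open>r\<^sup>2 exp(-2 K x)\<close> is nonincreasing and \<open>r\<^sup>2 exp(2 K x)\<close> is nondecreasing, so a zero of
  \<open>r\<close> spreads in both directions. The segment is unoriented so as to cover both.
\<close>

lemma gronwall_zero:
  fixes r r' :: "real \<Rightarrow> real"
  assumes r: "\<And>x. x \<in> closed_segment s t \<Longrightarrow> (r has_real_derivative r' x) (at x)"
    and K: "\<And>x. x \<in> closed_segment s t \<Longrightarrow> \<bar>r' x\<bar> \<le> K * \<bar>r x\<bar>"
    and "r s = 0"
  shows "r t = 0"
proof -
  have bound: "\<bar>2 * r x * r' x\<bar> \<le> 2 * K * (r x)\<^sup>2" if "x \<in> closed_segment s t" for x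
  proof -
    have square: "(r x)\<^sup>2 = \<bar>r x\<bar> * \<bar>r x\<bar>"
      by (simp add: power2_eq_square)
    have "2 * \<bar>r x\<bar> * \<bar>r' x\<bar> \<le> 2 * \<bar>r x\<bar> * (K * \<bar>r x\<bar>)"
      by (intro mult_left_mono K that) simp
    then show ?thesis
      unfolding square by (simp only: abs_mult abs_numeral mult_ac)
  qed
  have D: "((\<lambda>x. (r x)\<^sup>2 * exp (c * x)) has_real_derivative (2 * r x * r' x + c * (r x)\<^sup>2) * exp (c * x)) (at x)"
    if "x \<in> closed_segment s t" for x c
    by (auto intro!: derivative_eq_intros r[OF that] simp: algebra_simps power2_eq_square)
  show ?thesis
  proof (cases "s \<le> t")
    case True
    have "(r t)\<^sup>2 * exp (- (2 * K) * t) \<le> (r s)\<^sup>2 * exp (- (2 * K) * s)"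
    proof (rule DERIV_nonpos_imp_nonincreasing[OF True])
      fix x assume "s \<le> x" "x \<le> t"
      then have x: "x \<in> closed_segment s t"
        by (simp add: closed_segment_eq_real_ivl)
      have "(2 * r x * r' x + - (2 * K) * (r x)\<^sup>2) * exp (- (2 * K) * x) \<le> 0"
        using bound[OF x] by (simp add: mult_le_0_iff)
      then show "\<exists>y. ((\<lambda>x. (r x)\<^sup>2 * exp (- (2 * K) * x)) has_real_derivative y) (at x) \<and> y \<le> 0"
        using D[OF x] by blast
    qed
    then show ?thesis using assms(3) by (simp add: mult_le_0_iff)
  next
    case False
    then have le: "t \<le> s" by simp
    have "(r t)\<^sup>2 * exp (2 * K * t) \<le> (r s)\<^sup>2 * exp (2 * K * s)"
    proof (rule DERIV_nonneg_imp_nondecreasing[OF le])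
      fix x assume "t \<le> x" "x \<le> s"
      then have x: "x \<in> closed_segment s t"
        by (simp add: closed_segment_eq_real_ivl)
      have "0 \<le> (2 * r x * r' x + 2 * K * (r x)\<^sup>2) * exp (2 * K * x)"
        using bound[OF x] by simp
      then show "\<exists>y. ((\<lambda>x. (r x)\<^sup>2 * exp (2 * K * x)) has_real_derivative y) (at x) \<and> 0 \<le> y"
        using D[OF x] by blast
    qed
    then show ?thesis using assms(3) by (simp add: mult_le_0_iff)
  qed
qed

lemma scaled_tanh_has_derivative:
  "((\<lambda>t. \<alpha> * tanh (\<alpha> * c * t)) has_real_derivative c * (\<alpha>\<^sup>2 - (\<alpha> * tanh (\<alpha> * c * t))\<^sup>2)) (at (t::real))"
  by (auto intro!: derivative_eq_intros simp: power2_eq_square algebra_simps)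

lemma scaled_tanh_abs_less:
  "0 < \<alpha> \<Longrightarrow> \<bar>\<alpha> * tanh (x::real)\<bar> < \<alpha>"
  using tanh_real_bounds[of x] by (simp add: abs_mult abs_less_iff)

text \<open>
  The modulus on the left leaves the sign of \<open>u'\<close> free at each point. The sign can only change where
  \<open>u' = 0\<close>, that is where \<open>u = \<plusminus>\<alpha>\<close>; Gronwall, applied to \<open>u\<^sup>2 - \<alpha>\<^sup>2\<close>, excludes this because
  \<open>u\<^sup>2\<close> would then equal \<open>\<alpha>\<^sup>2\<close> everywhere, against \<open>u 0 = 0\<close>. Once the sign is known, Gronwall applied to the difference
  from the explicit solution finishes the proof.
\<close>

lemma eikonal_unique:
  fixes u v :: "real \<Rightarrow> real"
  assumes "0 < \<alpha>" "0 < c"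
    and u: "\<And>t. (u has_real_derivative v t) (at t)" and v: "continuous_on UNIV v"
    and eik: "\<And>t. \<bar>v t\<bar> = c * \<bar>(u t)\<^sup>2 - \<alpha>\<^sup>2\<bar>"
    and "u 0 = 0" and lim: "(u \<longlongrightarrow> \<alpha>) at_top"
  shows "u = (\<lambda>t. \<alpha> * tanh (\<alpha> * c * t))"
proof -
  have contu: "continuous_on A u" for A
    using u by (meson DERIV_continuous continuous_at_imp_continuous_on)
  have not_touching: "(u t)\<^sup>2 \<noteq> \<alpha>\<^sup>2" for t
  proof
    assume touch: "(u t)\<^sup>2 = \<alpha>\<^sup>2"
    have "compact (u ` closed_segment t 0)"
      by (intro compact_continuous_image contu compact_segment)
    then obtain M where M: "\<And>x. x \<in> closed_segment t 0 \<Longrightarrow> \<bar>u x\<bar> \<le> M"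
      using compact_imp_bounded by (force simp: bounded_iff)
    \<comment> \<open>Derivative \<open>2 u u'\<close>, bounded by \<open>2 M c |u\<^sup>2 - \<alpha>\<^sup>2|\<close>: the zero at \<open>t\<close> propagates back to 0.\<close>
    have "(u 0)\<^sup>2 - \<alpha>\<^sup>2 = 0"
    proof (rule gronwall_zero[of t 0 "\<lambda>x. (u x)\<^sup>2 - \<alpha>\<^sup>2" "\<lambda>x. 2 * u x * v x" "2 * M * c"])
      fix x assume x: "x \<in> closed_segment t 0"
      show "((\<lambda>x. (u x)\<^sup>2 - \<alpha>\<^sup>2) has_real_derivative 2 * u x * v x) (at x)"
        by (auto intro!: derivative_eq_intros u)
      show "\<bar>2 * u x * v x\<bar> \<le> 2 * M * c * \<bar>(u x)\<^sup>2 - \<alpha>\<^sup>2\<bar>"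
        using mult_right_mono[OF M[OF x], of "2 * c * \<bar>(u x)\<^sup>2 - \<alpha>\<^sup>2\<bar>"] assms(2)
        by (simp add: abs_mult eik mult_ac)
    qed (use touch in simp)
    then show False using assms by simp
  qed
  then have v_nz: "v t \<noteq> 0" for t
    using eik[of t] not_touching[of t] assms(2) by auto
  have u_less: "(u t)\<^sup>2 < \<alpha>\<^sup>2" for t
  proof (rule ccontr)
    assume "\<not> ?thesis"
    moreover have "connected ((\<lambda>t. (u t)\<^sup>2) ` UNIV)"
      by (intro connected_continuous_image continuous_intros contu connected_UNIV)
    ultimately have "\<alpha>\<^sup>2 \<in> (\<lambda>t. (u t)\<^sup>2) ` UNIV"
      using assms(1) \<open>u 0 = 0\<close> connectedD_interval[of _ "(u 0)\<^sup>2" "(u t)\<^sup>2" "\<alpha>\<^sup>2"] by simp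
    with not_touching show False by force
  qed
  obtain t where "0 < t" "0 < v t"
  proof -
    have "eventually (\<lambda>t. 0 < u t) at_top"
      using order_tendstoD(1)[OF lim assms(1)] .
    then obtain t where t: "0 < t" "0 < u t"
      using eventually_conj[OF _ eventually_gt_at_top[of 0]] eventually_happens' trivial_limit_at_top_linorder
      by (metis (no_types, lifting) eventually_happens)
    then obtain z where "0 < z" "u t - u 0 = (t - 0) * v z"
      using MVT2[of 0 t u v] u by auto
    then show ?thesis
      using that[of z] t \<open>u 0 = 0\<close> by (simp add: zero_less_mult_iff)
  qed
  have v_pos: "0 < v s" for s
  proof (rule ccontr)
    assume "\<not> ?thesis"
    moreover have "connected (v ` UNIV)"
      by (intro connected_continuous_image v connected_UNIV)
    ultimately have "0 \<in> v ` UNIV"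
      using \<open>0 < v t\<close> connectedD_interval[of _ "v s" "v t" 0] by simp
    with v_nz show False by auto
  qed
  have v_eq: "v t = c * (\<alpha>\<^sup>2 - (u t)\<^sup>2)" for t
    using eik[of t] v_pos[of t] u_less[of t] by simp
  define q where "q = (\<lambda>t. \<alpha> * tanh (\<alpha> * c * t))"
  have "u t - q t = 0" for t
  proof (rule gronwall_zero[of 0 t "\<lambda>x. u x - q x" "\<lambda>x. c * ((q x)\<^sup>2 - (u x)\<^sup>2)" "c * (2 * \<alpha>)"])
    fix x
    show "((\<lambda>x. u x - q x) has_real_derivative c * ((q x)\<^sup>2 - (u x)\<^sup>2)) (at x)"
      using DERIV_diff[OF u[of x] scaled_tanh_has_derivative[of \<alpha> c x]]
      unfolding v_eq q_def by (simp add: algebra_simps)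
    have "\<bar>u x\<bar> < \<alpha>"
      using u_less[of x] assms(1) abs_le_square_iff[of \<alpha> "u x"] by linarith
    moreover have "\<bar>q x\<bar> < \<alpha>"
      unfolding q_def by (rule scaled_tanh_abs_less[OF assms(1)])
    ultimately have "\<bar>u x + q x\<bar> \<le> 2 * \<alpha>"
      by linarith
    then have "\<bar>u x + q x\<bar> * (c * \<bar>u x - q x\<bar>) \<le> 2 * \<alpha> * (c * \<bar>u x - q x\<bar>)"
      using assms(2) by (intro mult_right_mono) auto
    moreover have "\<bar>c * ((q x)\<^sup>2 - (u x)\<^sup>2)\<bar> = \<bar>u x + q x\<bar> * (c * \<bar>u x - q x\<bar>)"
    proof -
      have "c * ((q x)\<^sup>2 - (u x)\<^sup>2) = - ((u x + q x) * (c * (u x - q x)))"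
        by (simp add: algebra_simps power2_eq_square)
      then show ?thesis using assms(2) by (simp add: abs_mult)
    qed
    ultimately show "\<bar>c * ((q x)\<^sup>2 - (u x)\<^sup>2)\<bar> \<le> c * (2 * \<alpha>) * \<bar>u x - q x\<bar>"
      by (simp add: mult_ac)
  qed (simp add: q_def assms)
  then show ?thesis
    by (auto simp: q_def)
qed

section \<open>The explicit solution\<close>

text \<open>
  Here \<open>q' = c (\<alpha>\<^sup>2 - q\<^sup>2) > 0\<close>, so the flux is a plain power and the chain rule applies. The
  factors \<open>c\<close> collect to \<open>c\<^sup>p\<close>, which cancels the factor \<open>p - 1\<close>; this is what fixes \<open>c\<close>.
\<close>

lemma scaled_tanh_solves_equation:
  fixes \<alpha> p :: real
  assumes "1 < p" "0 < \<alpha>" "0 < c" "c powr p = 1 / (p - 1)"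
  defines "q \<equiv> \<lambda>t. \<alpha> * tanh (\<alpha> * c * t)"
  shows "((\<lambda>s. p_flux p (c * (\<alpha>\<^sup>2 - (q s)\<^sup>2))) has_real_derivative
     2 * q t * p_flux p ((q t)\<^sup>2 - \<alpha>\<^sup>2)) (at t)"
proof -
  let ?y = "\<lambda>s. \<alpha>\<^sup>2 - (q s)\<^sup>2"
  have y: "0 < ?y s" for s
    using scaled_tanh_abs_less[OF assms(2), of "\<alpha> * c * s"] assms(2) abs_le_square_iff[of \<alpha> "q s"]
    unfolding q_def by linarith
  have flux: "p_flux p x = x powr (p - 1)" if "0 < x" for x
    using abs_p_flux[of p x] that by (simp add: p_flux_def)
  have q': "(q has_real_derivative c * ?y t) (at t)"
    unfolding q_def by (rule scaled_tanh_has_derivative)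
  have "((\<lambda>s. (c * ?y s) powr (p - 1)) has_real_derivative
     (p - 1) * (c * ?y t) powr (p - 1 - 1) * (c * - (2 * q t * (c * ?y t)))) (at t)"
    using y[of t] assms(3) by (auto intro!: derivative_eq_intros q')
  also have "(p - 1) * (c * ?y t) powr (p - 1 - 1) * (c * - (2 * q t * (c * ?y t))) =
      - 2 * q t * (((p - 1) * (c powr (p - 2) * c * c)) * (?y t powr (p - 2) * ?y t))"
    using y[of t] assms(3) by (simp add: powr_mult)
  also have "c powr (p - 2) * c * c = c powr p"
    using assms(3) powr_add[of c "p - 2" 2] by (simp add: power2_eq_square)
  also have "(p - 1) * c powr p = 1"
    using assms(1,4) by simp
  also have "- 2 * q t * (1 * (?y t powr (p - 2) * ?y t)) = 2 * q t * p_flux p ((q t)\<^sup>2 - \<alpha>\<^sup>2)"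
    using y[of t] by (simp add: p_flux_def abs_if algebra_simps)
  finally show ?thesis
    using y assms(3) by (simp add: flux)
qed

lemma scaled_tanh_C1_Holder_loc:
  fixes \<alpha> c :: real
  assumes "0 < \<alpha>" "0 < c" "0 < \<gamma>" "\<gamma> < 1"
  shows "C1_Holder_loc \<gamma> (\<lambda>t. \<alpha> * tanh (\<alpha> * c * t))"
proof (rule C1_Holder_loc_if_C11[OF scaled_tanh_has_derivative _ assms(3,4)])
  define q where "q = (\<lambda>t. \<alpha> * tanh (\<alpha> * c * t))"
  have bound: "\<bar>q t\<bar> \<le> \<alpha>" for t
    unfolding q_def by (intro less_imp_le scaled_tanh_abs_less assms)
  have q': "(q has_real_derivative c * (\<alpha>\<^sup>2 - (q t)\<^sup>2)) (at t)" for t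
    unfolding q_def by (rule scaled_tanh_has_derivative)
  have q'': "((\<lambda>t. c * (\<alpha>\<^sup>2 - (q t)\<^sup>2)) has_real_derivative - 2 * c\<^sup>2 * q t * (\<alpha>\<^sup>2 - (q t)\<^sup>2)) (at t)" for t
    by (auto intro!: derivative_eq_intros q' simp: power2_eq_square algebra_simps)
  have "\<bar>- 2 * c\<^sup>2 * q t * (\<alpha>\<^sup>2 - (q t)\<^sup>2)\<bar> \<le> 2 * c\<^sup>2 * \<alpha> * \<alpha>\<^sup>2" for t
  proof -
    have "(q t)\<^sup>2 \<le> \<alpha>\<^sup>2"
      using power_mono[OF bound[of t], of 2] by simp
    then have "\<bar>\<alpha>\<^sup>2 - (q t)\<^sup>2\<bar> \<le> \<alpha>\<^sup>2" by simp
    then show ?thesis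
      unfolding abs_mult using bound[of t] assms by (intro mult_mono) auto
  qed
  then show "\<bar>c * (\<alpha>\<^sup>2 - (\<alpha> * tanh (\<alpha> * c * x))\<^sup>2) - c * (\<alpha>\<^sup>2 - (\<alpha> * tanh (\<alpha> * c * y))\<^sup>2)\<bar>
      \<le> 2 * c\<^sup>2 * \<alpha> * \<alpha>\<^sup>2 * \<bar>x - y\<bar>" for x y
    using field_differentiable_bound[of UNIV "\<lambda>t. c * (\<alpha>\<^sup>2 - (q t)\<^sup>2)" "\<lambda>t. - 2 * c\<^sup>2 * q t * (\<alpha>\<^sup>2 - (q t)\<^sup>2)"
        "2 * c\<^sup>2 * \<alpha> * \<alpha>\<^sup>2" x y] q''
    by (simp add: q_def)
qed

section \<open>Heteroclinic solutions\<close>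

lemma weak_equation_iff_pointwise_equation:
  assumes "1 < p" "continuous_on UNIV u" "continuous_on UNIV (deriv u)" "continuous_on UNIV (deriv V)"
  shows "weak_equation p V u \<longleftrightarrow> pointwise_equation p V u"
  unfolding weak_equation_def pointwise_equation_iff
  by (rule weak_derivative_iff; rule continuous_on_compose2[of UNIV])
    (use assms continuous_on_p_flux[OF assms(1)] in auto)

lemma heteroclinic_solution_weak_iff_pointwise:
  assumes "1 < p"
  shows "heteroclinic_solution weak_equation p \<alpha> u \<longleftrightarrow> heteroclinic_solution pointwise_equation p \<alpha> u"
proof -
  have "weak_equation p (double_well p \<alpha>) u \<longleftrightarrow> pointwise_equation p (double_well p \<alpha>) u"
    if "0 < \<gamma>" "C1_Holder_loc \<gamma> u" for \<gamma>
  proof (rule weak_equation_iff_pointwise_equation[OF assms])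
    show "continuous_on UNIV u"
      using C1_Holder_loc_has_derivative[OF that(2)]
      by (meson DERIV_continuous continuous_at_imp_continuous_on)
  qed (use C1_Holder_loc_continuous_deriv[OF that(2,1)] continuous_on_deriv_double_well[OF assms] in auto)
  then show ?thesis
    unfolding heteroclinic_solution_def by blast
qed

lemma heteroclinic_solution_unique:
  assumes "1 < p" "0 < \<alpha>" "heteroclinic_solution pointwise_equation p \<alpha> u"
  shows "u = (\<lambda>t. \<alpha> * tanh (\<alpha> * (1 / (p - 1) powr (1 / p)) * t))"
proof -
  obtain \<gamma> where \<gamma>: "0 < \<gamma>" "C1_Holder_loc \<gamma> u"
    and eq: "pointwise_equation p (double_well p \<alpha>) u"
    and u: "u 0 = 0" "(u \<longlongrightarrow> \<alpha>) at_top"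
    using assms(3) unfolding heteroclinic_solution_def by blast
  note u' = C1_Holder_loc_has_derivative[OF \<gamma>(2)]
  show ?thesis
  proof (rule eikonal_unique[OF assms(2) _ u' C1_Holder_loc_continuous_deriv[OF \<gamma>(2,1)] _ u])
    show "0 < 1 / (p - 1) powr (1 / p)"
      using assms(1) by simp
    fix t
    have "(p - 1) / p * \<bar>deriv u t\<bar> powr p = double_well p \<alpha> (u t) - double_well p \<alpha> \<alpha>"
    proof (rule equipartition[OF assms(1) u' double_well_has_derivative[OF assms(1)] _ u(2)])
      show "((\<lambda>s. p_flux p (deriv u s)) has_real_derivative 2 * u t * p_flux p ((u t)\<^sup>2 - \<alpha>\<^sup>2)) (at t)" for t
        using eq unfolding pointwise_equation_iff deriv_double_well[OF assms(1)] by blast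
    qed
    then have "(p - 1) * \<bar>deriv u t\<bar> powr p = \<bar>(u t)\<^sup>2 - \<alpha>\<^sup>2\<bar> powr p"
      using assms(1) by (simp add: double_well_def)
    then have "((p - 1) * \<bar>deriv u t\<bar> powr p) powr (1 / p) = (\<bar>(u t)\<^sup>2 - \<alpha>\<^sup>2\<bar> powr p) powr (1 / p)"
      by simp
    then have "(p - 1) powr (1 / p) * \<bar>deriv u t\<bar> = \<bar>(u t)\<^sup>2 - \<alpha>\<^sup>2\<bar>"
      using assms(1) by (simp add: powr_mult powr_powr)
    then show "\<bar>deriv u t\<bar> = 1 / (p - 1) powr (1 / p) * \<bar>(u t)\<^sup>2 - \<alpha>\<^sup>2\<bar>"
      using assms(1) by (simp add: field_simps)
  qed
qed

lemma scaled_tanh_heteroclinic_solution: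
  assumes "1 < p" "0 < \<alpha>"
  shows "heteroclinic_solution pointwise_equation p \<alpha> (\<lambda>t. \<alpha> * tanh (\<alpha> * (1 / (p - 1) powr (1 / p)) * t))"
    (is "heteroclinic_solution _ _ _ ?q")
proof -
  define c where "c = 1 / (p - 1) powr (1 / p)"
  have c: "0 < c" "c powr p = 1 / (p - 1)"
    using assms(1) by (simp_all add: c_def powr_divide powr_powr)
  have "C1_Holder_loc (1 / 2) ?q"
    unfolding c_def[symmetric] by (rule scaled_tanh_C1_Holder_loc[OF assms(2) c(1)]) simp_all
  moreover have "pointwise_equation p (double_well p \<alpha>) ?q"
  proof -
    have "deriv ?q = (\<lambda>t. c * (\<alpha>\<^sup>2 - (?q t)\<^sup>2))"
      unfolding c_def[symmetric] using scaled_tanh_has_derivative by (blast intro: DERIV_imp_deriv)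
    then show ?thesis
      using scaled_tanh_solves_equation[OF assms c]
      by (simp only: pointwise_equation_iff deriv_double_well[OF assms(1)] c_def[symmetric]) blast
  qed
  moreover have "(?q \<longlongrightarrow> \<alpha> * 1) at_top" "(?q \<longlongrightarrow> \<alpha> * - 1) at_bot"
  proof -
    have ac: "0 < \<alpha> * c"
      using assms(2) c(1) by simp
    have "filterlim (\<lambda>t. \<alpha> * c * t) at_top at_top"
      by (rule filterlim_tendsto_pos_mult_at_top[OF tendsto_const ac filterlim_ident])
    then show "(?q \<longlongrightarrow> \<alpha> * 1) at_top"
      unfolding c_def[symmetric] by (intro tendsto_mult tendsto_const filterlim_compose[OF tanh_real_at_top])
    have "filterlim (\<lambda>t. \<alpha> * c * t) at_bot at_bot"
      by (rule filterlim_tendsto_pos_mult_at_bot[OF tendsto_const ac filterlim_ident])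
    then show "(?q \<longlongrightarrow> \<alpha> * - 1) at_bot"
      unfolding c_def[symmetric] by (intro tendsto_mult tendsto_const filterlim_compose[OF tanh_real_at_bot])
  qed
  ultimately show ?thesis
    unfolding heteroclinic_solution_def by (intro conjI exI[of _ "1 / 2"]) auto
qed

theorem theorem1p2:
  fixes p \<alpha> :: real
  assumes "1 < p" and "0 < \<alpha>"
  defines "q \<equiv> \<lambda>t::real. \<alpha> * tanh (\<alpha> * t / (p - 1) powr (1 / p))"
  shows "(\<forall>u. heteroclinic_solution pointwise_equation p \<alpha> u \<longleftrightarrow> u = q) \<and>
         (\<forall>u. heteroclinic_solution weak_equation p \<alpha> u \<longleftrightarrow> u = q)"
proof -
  have q: "q = (\<lambda>t. \<alpha> * tanh (\<alpha> * (1 / (p - 1) powr (1 / p)) * t))"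
    by (simp add: q_def)
  have "heteroclinic_solution pointwise_equation p \<alpha> u \<longleftrightarrow> u = q" for u
    unfolding q using heteroclinic_solution_unique[OF assms(1,2)]
      scaled_tanh_heteroclinic_solution[OF assms(1,2)] by blast
  then show ?thesis
    by (simp add: heteroclinic_solution_weak_iff_pointwise[OF assms(1)])
qed

end
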